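(* Let $X$ be a regular topological space. For a property $A$ of $X$, a cardinal $\kappa$ and a property $B$, write $(A,(<\kappa,B))$ for "$X$ has property $A$ and $X$ is a union of fewer than $\kappa$ subspaces each of which has property $B$". Let $H$, $M$ denote Hurewicz and Menger; $SL$, $SSL$ star-Lindelöf and strongly star-Lindelöf; $SM$, $SSM$ star-Menger and strongly star-Menger; $SH$, $SSH$ star-Hurewicz and strongly star-Hurewicz. Then all of the following implications hold for $X$: (1) $(SSL,(<\mathfrak{d},H))\Rightarrow SSM$; (2) $(SSL,(<\mathfrak{b},H))\Rightarrow SSH$; (3) $(SSL,(<\mathfrak{b},M))\Rightarrow SSM$; (4) $(SL,(<\mathfrak{d},H))\Rightarrow SM$; (5) $(SL,(<\mathfrak{b},H))\Rightarrow SH$; (6) $(SL,(<\mathfrak{b},M))\Rightarrow SM$; (7) $(SSL,(<\mathfrak{b},H))\Rightarrow(SSL,(<\mathfrak{d},H))$ and $(SSL,(<\mathfrak{b},H))\Rightarrow(SSL,(<\mathfrak{b},M))$; (8) $(SL,(<\mathfrak{b},H))\Rightarrow(SL,(<\mathfrak{d},H))$ and $(SL,(<\mathfrak{b},H))\Rightarrow(SL,(<\mathfrak{b},M))$; (9) $(SSL,(<\mathfrak{d},H))\Rightarrow(SL,(<\mathfrak{d},H))$, $(SSL,(<\mathfrak{b},H))\Rightarrow(SL,(<\mathfrak{b},H))$ and $(SSL,(<\mathfrak{b},M))\Rightarrow(SL,(<\mathfrak{b},M))$; (10) $SSH\Rightarrow SSM$, $SH\Rightarrow SM$, $SSH\Rightarrow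 SH$ and $SSM\Rightarrow SM$.
   Context: Regular spaces are assumed to be $T_1$. For a family $\mathcal{U}$ of subsets of $X$ and $A\subseteq X$, $St(A,\mathcal{U})=\bigcup\{U\in\mathcal{U}: U\cap A\neq\emptyset\}$. A space $X$ is: - strongly star-Lindelöf ($SSL$) if for every open cover $\mathcal{U}$ there is a countable $F\subseteq X$ with $St(F,\mathcal{U})=X$; - star-Lindelöf ($SL$) if for every open cover $\mathcal{U}$ there is a countable $\mathcal{V}\subseteq\mathcal{U}$ with $St(\bigcup\mathcal{V},\mathcal{U})=X$. In the following, $\{\mathcal{U}_n:n\in\omega\}$ ranges over all sequences of open covers of $X$. The space $X$ is: - Menger ($M$) if there are finite $\mathcal{V}_n\subseteq\mathcal{U}_n$ such that $\{\bigcup\mathcal{V}_n:n\in\omega\}$ covers $X$; - Hurewicz ($H$) if there are finite $\mathcal{V}_n\subseteq\mathcal{U}_n$ such that each $x\in X$ is in $\bigcup\mathcal{V}_n$ for all but finitely many $n$; - star-Menger ($SM$) if there are finite $\mathcal{V}_n\subseteq\mathcal{U}_n$ such that $\{St(\bigcup\mathcal{V}_n,\mathcal{U}_n):n\in\omega\}$ covers $X$; - strongly star-Menger ($SSM$) if there are finite $F_n\subseteq X$ such that $\{St(F_n,\mathcal{U}_n):n\in\omega\}$ covers $X$; - star-Hurewicz ($SH$) if there are finite $\mathcal{V}_n\subseteq\mathcal{U}_n$ such that each $x\in X$ is in $St(\bigcup\mathcal{V}_n,\mathcal{U}_n)$ for all but finitely many $n$; - strongly star-Hurewicz ($SSH$)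 if there are finite $F_n\subseteq X$ such that each $x\in X$ is in $St(F_n,\mathcal{U}_n)$ for all but finitely many $n$. For $f,g\in\omega^\omega$, $f\leq^* g$ means $f(n)\leq g(n)$ for all but finitely many $n$. $\mathfrak{b}$ is the least cardinality of a subset of $\omega^\omega$ that is unbounded with respect to $\leq^*$; $\mathfrak{d}$ is the least cardinality of a set $D\subseteq\omega^\omega$ that is dominating (every $g\in\omega^\omega$ satisfies $g\leq^* f$ for some $f\in D$). *)

theory Defs
  imports "HOL-Analysis.Analysis"
begin

unbundle cardinal_syntax

definition le_star :: "(nat \<Rightarrow> nat) \<Rightarrow> (nat \<Rightarrow> nat) \<Rightarrow> bool" (infix \<open>\<le>\<^sup>*\<close> 50)
  where "f \<le>\<^sup>* g \<longleftrightarrow> (\<forall>\<^sub>\<infinity>n. f n \<le> g n)"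

definition unbounded_family :: "(nat \<Rightarrow> nat) set \<Rightarrow> bool"
  where "unbounded_family S \<longleftrightarrow> \<not> (\<exists>g. \<forall>f\<in>S. f \<le>\<^sup>* g)"

definition dominating_family :: "(nat \<Rightarrow> nat) set \<Rightarrow> bool"
  where "dominating_family D \<longleftrightarrow> (\<forall>g. \<exists>f\<in>D. g \<le>\<^sup>* f)"

text \<open>Cardinals are represented, as in the library, by well-order relations up to order
  isomorphism. \<open>least_cardinality P\<close> is the cardinality of a set of minimal cardinality among
  those satisfying \<open>P\<close>; such a set exists as soon as some set satisfies \<open>P\<close>.\<close>

definition least_cardinality :: "('a set \<Rightarrow> bool) \<Rightarrow> 'a rel"
  where "least_cardinality P = |SOME S. P S \<and> (\<forall>T. P T \<longrightarrow> |S| \<le>o |T| )|"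

definition bounding_number :: "(nat \<Rightarrow> nat) rel"  (\<open>\<bb>\<close>)
  where "\<bb> = least_cardinality unbounded_family"

definition dominating_number :: "(nat \<Rightarrow> nat) rel"  (\<open>\<dd>\<close>)
  where "\<dd> = least_cardinality dominating_family"

lemma least_cardinality:
  assumes "P S0"
  shows "\<exists>S. P S \<and> least_cardinality P = |S|"
    and "P T \<Longrightarrow> least_cardinality P \<le>o |T|"
proof -
  have "\<exists>r \<in> card_of ` Collect P. \<forall>r' \<in> card_of ` Collect P. r \<le>o r'"
    by (rule exists_minim_Card_order) (use assms card_of_Card_order in auto)
  then have "\<exists>S. P S \<and> (\<forall>T. P T \<longrightarrow> |S| \<le>o |T| )"
    by auto
  from someI_ex[OF this]
  show "\<exists>S. P S \<and> least_cardinality P = |S|" "P T \<Longrightarrow> least_cardinality P \<le>o |T|"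
    by (auto simp: least_cardinality_def)
qed

lemma dominating_family_UNIV: "dominating_family UNIV"
  unfolding dominating_family_def
proof
  fix g :: "nat \<Rightarrow> nat"
  have "g \<le>\<^sup>* g" by (simp add: le_star_def)
  then show "\<exists>f\<in>UNIV. g \<le>\<^sup>* f" by blast
qed

lemma dominating_imp_unbounded:
  assumes "dominating_family D"
  shows "unbounded_family D"
  unfolding unbounded_family_def
proof
  assume "\<exists>g. \<forall>f\<in>D. f \<le>\<^sup>* g"
  then obtain g where g: "\<forall>f\<in>D. f \<le>\<^sup>* g" by blast
  obtain f where "f \<in> D" and "(\<lambda>n. Suc (g n)) \<le>\<^sup>* f"
    using assms unfolding dominating_family_def by blast
  with g have "\<forall>\<^sub>\<infinity>n. f n \<le> g n \<and> Suc (g n) \<le> f n"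
    by (auto simp: le_star_def intro: eventually_conj)
  then have "\<forall>\<^sub>\<infinity>n::nat. False"
    by (rule eventually_mono) auto
  then show False by simp
qed

lemma unbounded_family_UNIV: "unbounded_family UNIV"
  using dominating_family_UNIV by (rule dominating_imp_unbounded)

definition open_cover :: "'a topology \<Rightarrow> 'a set set \<Rightarrow> bool"
  where "open_cover X \<U> \<longleftrightarrow> (\<forall>U\<in>\<U>. openin X U) \<and> \<Union>\<U> = topspace X"

definition St :: "'a set \<Rightarrow> 'a set set \<Rightarrow> 'a set"
  where "St A \<U> = \<Union>{U \<in> \<U>. U \<inter> A \<noteq> {}}"

definition strongly_star_Lindelof :: "'a topology \<Rightarrow> bool"
  where "strongly_star_Lindelof X \<longleftrightarrow>
    (\<forall>\<U>. open_cover X \<U> \<longrightarrow>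
      (\<exists>F. countable F \<and> F \<subseteq> topspace X \<and> St F \<U> = topspace X))"

definition star_Lindelof :: "'a topology \<Rightarrow> bool"
  where "star_Lindelof X \<longleftrightarrow>
    (\<forall>\<U>. open_cover X \<U> \<longrightarrow>
      (\<exists>\<V>. countable \<V> \<and> \<V> \<subseteq> \<U> \<and> St (\<Union>\<V>) \<U> = topspace X))"

definition Menger :: "'a topology \<Rightarrow> bool"
  where "Menger X \<longleftrightarrow>
    (\<forall>\<U> :: nat \<Rightarrow> 'a set set. (\<forall>n. open_cover X (\<U> n)) \<longrightarrow>
      (\<exists>\<V>. (\<forall>n. finite (\<V> n) \<and> \<V> n \<subseteq> \<U> n) \<and> (\<Union>n. \<Union>(\<V> n)) = topspace X))"

definition Hurewicz :: "'a topology \<Rightarrow> bool"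
  where "Hurewicz X \<longleftrightarrow>
    (\<forall>\<U> :: nat \<Rightarrow> 'a set set. (\<forall>n. open_cover X (\<U> n)) \<longrightarrow>
      (\<exists>\<V>. (\<forall>n. finite (\<V> n) \<and> \<V> n \<subseteq> \<U> n) \<and>
        (\<forall>x\<in>topspace X. \<forall>\<^sub>\<infinity>n. x \<in> \<Union>(\<V> n))))"

definition star_Menger :: "'a topology \<Rightarrow> bool"
  where "star_Menger X \<longleftrightarrow>
    (\<forall>\<U> :: nat \<Rightarrow> 'a set set. (\<forall>n. open_cover X (\<U> n)) \<longrightarrow>
      (\<exists>\<V>. (\<forall>n. finite (\<V> n) \<and> \<V> n \<subseteq> \<U> n) \<and>
        (\<Union>n. St (\<Union>(\<V> n)) (\<U> n)) = topspace X))"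

definition strongly_star_Menger :: "'a topology \<Rightarrow> bool"
  where "strongly_star_Menger X \<longleftrightarrow>
    (\<forall>\<U> :: nat \<Rightarrow> 'a set set. (\<forall>n. open_cover X (\<U> n)) \<longrightarrow>
      (\<exists>F. (\<forall>n. finite (F n) \<and> F n \<subseteq> topspace X) \<and>
        (\<Union>n. St (F n) (\<U> n)) = topspace X))"

definition star_Hurewicz :: "'a topology \<Rightarrow> bool"
  where "star_Hurewicz X \<longleftrightarrow>
    (\<forall>\<U> :: nat \<Rightarrow> 'a set set. (\<forall>n. open_cover X (\<U> n)) \<longrightarrow>
      (\<exists>\<V>. (\<forall>n. finite (\<V> n) \<and> \<V> n \<subseteq> \<U> n) \<and>
        (\<forall>x\<in>topspace X. \<forall>\<^sub>\<infinity>n. x \<in> St (\<Union>(\<V> n)) (\<U> n))))"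

definition strongly_star_Hurewicz :: "'a topology \<Rightarrow> bool"
  where "strongly_star_Hurewicz X \<longleftrightarrow>
    (\<forall>\<U> :: nat \<Rightarrow> 'a set set. (\<forall>n. open_cover X (\<U> n)) \<longrightarrow>
      (\<exists>F. (\<forall>n. finite (F n) \<and> F n \<subseteq> topspace X) \<and>
        (\<forall>x\<in>topspace X. \<forall>\<^sub>\<infinity>n. x \<in> St (F n) (\<U> n))))"

text \<open>\<open>with_union A \<kappa> B X\<close> is the property $(A,({<}\kappa,B))$ of \<open>X\<close>; the subspaces are given by
  a set of subsets of \<open>topspace X\<close> carrying the subspace topology.\<close>

definition with_union ::
    "('a topology \<Rightarrow> bool) \<Rightarrow> 'k rel \<Rightarrow> ('a topology \<Rightarrow> bool) \<Rightarrow> 'a topology \<Rightarrow> bool"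
  where "with_union A \<kappa> B X \<longleftrightarrow>
    A X \<and> (\<exists>\<Y>. |\<Y>| <o \<kappa> \<and> \<Union>\<Y> = topspace X \<and> (\<forall>Y\<in>\<Y>. B (subtopology X Y)))"

end

theory Submission
  imports Defs
begin

text \<open>
  The six implications that end in a star selection principle share one mechanism. Fix open
  covers \<open>\<U> n\<close>. If \<open>X\<close> is (strongly) star-Lindelof, a countable kernel for \<open>\<U> n\<close>, made
  of points or of members of \<open>\<U> n\<close>, can be exhausted by finite sets \<open>E n 0 \<subseteq> E n 1 \<subseteq> \<dots>\<close>, and the stars of these finite sets form an
  increasing open cover \<open>W n 0 \<subseteq> W n 1 \<subseteq> \<dots>\<close> of \<open>X\<close>. Choosing a finite kernel for each \<open>n\<close>
  then amounts to choosing one function \<open>g\<close>, namely the sets \<open>E n (g n)\<close>; the principle says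
  that every point lies in \<open>W n (g n)\<close> for some, or for almost all, \<open>n\<close>.

  On a Hurewicz piece \<open>Y\<close> there is a function \<open>f\<close> such that each point of \<open>Y\<close> is in \<open>W n (f n)\<close>
  for almost all \<open>n\<close>; on a Menger piece there is one for which this happens infinitely often
  (lemmas \<open>Hurewicz_subspace_function\<close> and \<open>Menger_subspace_function\<close>). Since \<open>W n\<close> increases, it
  remains to find one \<open>g\<close> that exceeds the functions of all pieces often enough:
  fewer than \<open>\<bb>\<close> functions have a common eventual upper bound, which preserves both
  ``almost all'' and ``infinitely many'', while fewer than \<open>\<dd>\<close> functions admit a \<open>g\<close>
  exceeding each of them infinitely often, and an infinite set of indices meets a cofinite one.

  The other implications come from \<open>\<bb> \<le> \<dd>\<close>, from ``almost all'' being stronger than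
  ``some'', and from replacing each kernel point by a member of the cover that contains it.
\<close>

section \<open>Small families of functions\<close>

lemma bounded_if_less_bounding_number:
  fixes f :: "'i \<Rightarrow> nat \<Rightarrow> nat"
  assumes "|I| <o \<bb>"
  shows "\<exists>g. \<forall>i\<in>I. f i \<le>\<^sup>* g"
proof -
  have "|f ` I| <o \<bb>"
    using card_of_image assms by (rule ordLeq_ordLess_trans)
  then have "\<not> unbounded_family (f ` I)"
    unfolding bounding_number_def
    using least_cardinality(2)[of unbounded_family, OF unbounded_family_UNIV]
      not_ordLess_ordLeq by blast
  then show ?thesis
    unfolding unbounded_family_def by blast
qed

lemma exceeded_if_less_dominating_number:
  fixes f :: "'i \<Rightarrow> nat \<Rightarrow> nat"
  assumes "|I| <o \<dd>"
  shows "\<exists>g. \<forall>i\<in>I. \<exists>\<^sub>\<infinity>n. f i n < g n"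
proof -
  have "|f ` I| <o \<dd>"
    using card_of_image assms by (rule ordLeq_ordLess_trans)
  then have "\<not> dominating_family (f ` I)"
    unfolding dominating_number_def
    using least_cardinality(2)[of dominating_family, OF dominating_family_UNIV]
      not_ordLess_ordLeq by blast
  then obtain g where "\<forall>i\<in>I. \<not> g \<le>\<^sup>* f i"
    unfolding dominating_family_def by blast
  then show ?thesis
    by (auto simp: le_star_def not_eventually not_le)
qed

text \<open>A dominating family is unbounded, so a dominating family of least size witnesses the
  inequality.\<close>

lemma bounding_number_le_dominating_number: "\<bb> \<le>o \<dd>"
proof -
  obtain D where "dominating_family D" and D: "\<dd> = |D|"
    using least_cardinality(1)[of dominating_family, OF dominating_family_UNIV]
    unfolding dominating_number_def by blast
  then have "unbounded_family D"
    by (intro dominating_imp_unbounded)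
  then show ?thesis
    unfolding D bounding_number_def
    by (rule least_cardinality(2)[of unbounded_family, OF unbounded_family_UNIV])
qed

section \<open>Sequences of increasing open covers\<close>

text \<open>An increasing cover is the shape a countable cover takes once it is replaced by the unions
  of its finite initial parts; choosing finitely many of its members is choosing one index.\<close>

definition increasing_covers :: "'a topology \<Rightarrow> (nat \<Rightarrow> nat \<Rightarrow> 'a set) \<Rightarrow> bool"
  where "increasing_covers X W \<longleftrightarrow>
    (\<forall>n. mono (W n) \<and> open_cover X (range (W n)))"

lemma increasing_coversD:
  assumes "increasing_covers X W"
  shows "m \<le> m' \<Longrightarrow> x \<in> W n m \<Longrightarrow> x \<in> W n m'"
  using assms unfolding increasing_covers_def mono_def by blast

lemma increasing_covers_subtopology:
  assumes "increasing_covers X W"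
  shows "increasing_covers (subtopology X Y) (\<lambda>n m. W n m \<inter> Y)"
  using assms unfolding increasing_covers_def open_cover_def mono_def
  by (simp add: openin_subtopology_Int flip: Int_UN_distrib2) blast

text \<open>The largest of finitely many indices gives a member containing all the others. This turns
  the finite selections of the Hurewicz and Menger properties into functions on the natural
  numbers.\<close>

lemma finite_selection_function:
  assumes "increasing_covers X W"
    and "\<forall>n. finite (\<V> n) \<and> \<V> n \<subseteq> range (W n)"
  shows "\<exists>f. \<forall>n. \<Union>(\<V> n) \<subseteq> W n (f n)"
proof -
  have "\<exists>m. \<Union>(\<V> n) \<subseteq> W n m" for n
  proof -
    obtain K where K: "finite K" "\<V> n = W n ` K"
      using assms(2) finite_subset_image[of "\<V> n" "W n" UNIV] by blast
    have "W n k \<subseteq> W n (Max K)" if "k \<in> K" for k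
      using increasing_coversD[OF assms(1)] Max_ge[OF K(1) that] by blast
    then show ?thesis
      unfolding K(2) by blast
  qed
  then show ?thesis
    by metis
qed

lemma Hurewicz_function:
  assumes "Hurewicz X" "increasing_covers X W"
  shows "\<exists>f. \<forall>x\<in>topspace X. \<forall>\<^sub>\<infinity>n. x \<in> W n (f n)"
proof -
  have "open_cover X (range (W n))" for n
    using assms(2) by (simp add: increasing_covers_def)
  from assms(1)[unfolded Hurewicz_def, rule_format, of "\<lambda>n. range (W n)", OF this] obtain \<V>
    where \<V>: "\<forall>n. finite (\<V> n) \<and> \<V> n \<subseteq> range (W n)"
      and cover: "\<forall>x\<in>topspace X. \<forall>\<^sub>\<infinity>n. x \<in> \<Union>(\<V> n)"
    by auto
  obtain f where f: "\<forall>n. \<Union>(\<V> n) \<subseteq> W n (f n)"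
    using finite_selection_function[OF assms(2) \<V>] ..
  show ?thesis
  proof (intro exI[of _ f] ballI)
    fix x assume "x \<in> topspace X"
    then have "\<forall>\<^sub>\<infinity>n. x \<in> \<Union>(\<V> n)"
      using cover by simp
    then show "\<forall>\<^sub>\<infinity>n. x \<in> W n (f n)"
      by eventually_elim (use f in blast)
  qed
qed

lemma Menger_function:
  assumes "Menger X" "increasing_covers X W"
  shows "\<exists>f. \<forall>x\<in>topspace X. \<exists>n. x \<in> W n (f n)"
proof -
  have "open_cover X (range (W n))" for n
    using assms(2) by (simp add: increasing_covers_def)
  from assms(1)[unfolded Menger_def, rule_format, of "\<lambda>n. range (W n)", OF this] obtain \<V>
    where \<V>: "\<forall>n. finite (\<V> n) \<and> \<V> n \<subseteq> range (W n)"
      and cover: "(\<Union>n. \<Union>(\<V> n)) = topspace X"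
    by auto
  obtain f where f: "\<forall>n. \<Union>(\<V> n) \<subseteq> W n (f n)"
    using finite_selection_function[OF assms(2) \<V>] ..
  show ?thesis
  proof (intro exI[of _ f] ballI)
    fix x assume "x \<in> topspace X"
    then obtain n where "x \<in> \<Union>(\<V> n)"
      using cover by blast
    then show "\<exists>n. x \<in> W n (f n)"
      using f by blast
  qed
qed

text \<open>Being covered once is not stable under passing to an eventual upper bound, because the one
  good index may be among the finitely many exceptions. The Menger property applied to every
  tail of the sequence gives functions \<open>F k\<close>, and their diagonal maximum covers each point
  infinitely often.\<close>

lemma Menger_function_infinitely_often:
  assumes "Menger X" "increasing_covers X W"
  shows "\<exists>f. \<forall>x\<in>topspace X. \<exists>\<^sub>\<infinity>n. x \<in> W n (f n)"
proof -
  have "\<exists>f. \<forall>x\<in>topspace X. \<exists>n. x \<in> W (k + n) (f n)" for k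
  proof -
    have "increasing_covers X (\<lambda>n. W (k + n))"
      using assms(2) by (simp add: increasing_covers_def)
    then show ?thesis
      using Menger_function[OF assms(1)] by metis
  qed
  then obtain F where F: "\<And>k x. x \<in> topspace X \<Longrightarrow> \<exists>n. x \<in> W (k + n) (F k n)"
    by metis
  \<comment> \<open>\<open>F k m\<close> refers to the cover of index \<open>k + m\<close>, so tail \<open>k\<close> contributes \<open>F k (n - k)\<close> at \<open>n\<close>\<close>
  define f where "f n = Max ((\<lambda>k. F k (n - k)) ` {..n})" for n
  have le: "F k n \<le> f (k + n)" for k n
    unfolding f_def by (rule Max_ge) (auto intro!: image_eqI[where x = k])
  show ?thesis
  proof (intro exI[of _ f] ballI)
    fix x assume "x \<in> topspace X"
    have "\<exists>n\<ge>k. x \<in> W n (f n)" for k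
    proof -
      obtain n where "x \<in> W (k + n) (F k n)"
        using F \<open>x \<in> topspace X\<close> by blast
      then have "x \<in> W (k + n) (f (k + n))"
        by (rule increasing_coversD[OF assms(2) le])
      then show ?thesis
        using le_add1 by blast
    qed
    then show "\<exists>\<^sub>\<infinity>n. x \<in> W n (f n)"
      by (simp add: INFM_nat_le)
  qed
qed

lemma Hurewicz_subspace_function:
  assumes "Hurewicz (subtopology X Y)" "increasing_covers X W"
  shows "\<exists>f. \<forall>x\<in>topspace X \<inter> Y. \<forall>\<^sub>\<infinity>n. x \<in> W n (f n)"
proof -
  obtain f where "\<forall>x\<in>topspace (subtopology X Y). \<forall>\<^sub>\<infinity>n. x \<in> W n (f n) \<inter> Y"
    using Hurewicz_function[OF assms(1) increasing_covers_subtopology[OF assms(2)]] ..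
  then show ?thesis
    by (auto simp: eventually_conj_iff)
qed

lemma Menger_subspace_function:
  assumes "Menger (subtopology X Y)" "increasing_covers X W"
  shows "\<exists>f. \<forall>x\<in>topspace X \<inter> Y. \<exists>\<^sub>\<infinity>n. x \<in> W n (f n)"
proof -
  obtain f where "\<forall>x\<in>topspace (subtopology X Y). \<exists>\<^sub>\<infinity>n. x \<in> W n (f n) \<inter> Y"
    using Menger_function_infinitely_often
      [OF assms(1) increasing_covers_subtopology[OF assms(2)]] ..
  then show ?thesis
    by (fastforce elim: frequently_elim1)
qed

section \<open>One function for the union of few pieces\<close>

text \<open>Each piece contributes a function, and the smallness of the number of pieces yields one
  \<open>g\<close> against all of them. For fewer than \<open>\<dd>\<close> pieces \<open>g\<close> exceeds the function of a piece only
  infinitely often, at indices that cannot be prescribed; covering a point by its Hurewicz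
  piece at all but finitely many indices makes every choice of such indices harmless.\<close>

lemma union_less_dominating_Hurewicz_function:
  assumes "with_union A \<dd> Hurewicz X" "increasing_covers X W"
  shows "\<exists>g. \<forall>x\<in>topspace X. \<exists>\<^sub>\<infinity>n. x \<in> W n (g n)"
proof -
  obtain \<Y> where \<Y>: "|\<Y>| <o \<dd>" "\<Union>\<Y> = topspace X" "\<And>Y. Y \<in> \<Y> \<Longrightarrow> Hurewicz (subtopology X Y)"
    using assms(1) unfolding with_union_def by blast
  have "\<forall>Y\<in>\<Y>. \<exists>f. \<forall>x\<in>topspace X \<inter> Y. \<forall>\<^sub>\<infinity>n. x \<in> W n (f n)"
    using Hurewicz_subspace_function[OF _ assms(2)] \<Y>(3) by simp
  then obtain f where "\<forall>Y\<in>\<Y>. \<forall>x\<in>topspace X \<inter> Y. \<forall>\<^sub>\<infinity>n. x \<in> W n (f Y n)"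
    by metis
  then have f: "\<And>Y x. Y \<in> \<Y> \<Longrightarrow> x \<in> topspace X \<Longrightarrow> x \<in> Y \<Longrightarrow> \<forall>\<^sub>\<infinity>n. x \<in> W n (f Y n)"
    by blast
  obtain g where g: "\<forall>Y\<in>\<Y>. \<exists>\<^sub>\<infinity>n. f Y n < g n"
    using exceeded_if_less_dominating_number[OF \<Y>(1), where f = f] ..
  show ?thesis
  proof (intro exI[of _ g] ballI)
    fix x assume x: "x \<in> topspace X"
    then obtain Y where Y: "Y \<in> \<Y>" "x \<in> Y"
      using \<Y>(2) by blast
    \<comment> \<open>at almost every index, exceeding \<open>f Y\<close> is enough for \<open>x\<close> to be covered\<close>
    have "\<forall>\<^sub>\<infinity>n. f Y n < g n \<longrightarrow> x \<in> W n (g n)"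
      using f[OF Y(1) x Y(2)]
      by eventually_elim (blast intro: increasing_coversD[OF assms(2)] less_imp_le)
    then show "\<exists>\<^sub>\<infinity>n. x \<in> W n (g n)"
      using g[rule_format, OF Y(1)] by (rule frequently_mp)
  qed
qed

text \<open>An eventual upper bound leaves only finitely many exceptions, so it transfers both kinds of
  covering: almost all indices from Hurewicz pieces here, and infinitely many indices from
  Menger pieces in the lemma that follows.\<close>

lemma union_less_bounding_Hurewicz_function:
  assumes "with_union A \<bb> Hurewicz X" "increasing_covers X W"
  shows "\<exists>g. \<forall>x\<in>topspace X. \<forall>\<^sub>\<infinity>n. x \<in> W n (g n)"
proof -
  obtain \<Y> where \<Y>: "|\<Y>| <o \<bb>" "\<Union>\<Y> = topspace X" "\<And>Y. Y \<in> \<Y> \<Longrightarrow> Hurewicz (subtopology X Y)"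
    using assms(1) unfolding with_union_def by blast
  have "\<forall>Y\<in>\<Y>. \<exists>f. \<forall>x\<in>topspace X \<inter> Y. \<forall>\<^sub>\<infinity>n. x \<in> W n (f n)"
    using Hurewicz_subspace_function[OF _ assms(2)] \<Y>(3) by simp
  then obtain f where "\<forall>Y\<in>\<Y>. \<forall>x\<in>topspace X \<inter> Y. \<forall>\<^sub>\<infinity>n. x \<in> W n (f Y n)"
    by metis
  then have f: "\<And>Y x. Y \<in> \<Y> \<Longrightarrow> x \<in> topspace X \<Longrightarrow> x \<in> Y \<Longrightarrow> \<forall>\<^sub>\<infinity>n. x \<in> W n (f Y n)"
    by blast
  obtain g where g: "\<forall>Y\<in>\<Y>. \<forall>\<^sub>\<infinity>n. f Y n \<le> g n"
    using bounded_if_less_bounding_number[OF \<Y>(1), where f = f] unfolding le_star_def ..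
  show ?thesis
  proof (intro exI[of _ g] ballI)
    fix x assume x: "x \<in> topspace X"
    then obtain Y where Y: "Y \<in> \<Y>" "x \<in> Y"
      using \<Y>(2) by blast
    show "\<forall>\<^sub>\<infinity>n. x \<in> W n (g n)"
      using f[OF Y(1) x Y(2)] g[rule_format, OF Y(1)]
      by eventually_elim (rule increasing_coversD[OF assms(2)])
  qed
qed

lemma union_less_bounding_Menger_function:
  assumes "with_union A \<bb> Menger X" "increasing_covers X W"
  shows "\<exists>g. \<forall>x\<in>topspace X. \<exists>\<^sub>\<infinity>n. x \<in> W n (g n)"
proof -
  obtain \<Y> where \<Y>: "|\<Y>| <o \<bb>" "\<Union>\<Y> = topspace X" "\<And>Y. Y \<in> \<Y> \<Longrightarrow> Menger (subtopology X Y)"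
    using assms(1) unfolding with_union_def by blast
  have "\<forall>Y\<in>\<Y>. \<exists>f. \<forall>x\<in>topspace X \<inter> Y. \<exists>\<^sub>\<infinity>n. x \<in> W n (f n)"
    using Menger_subspace_function[OF _ assms(2)] \<Y>(3) by simp
  then obtain f where "\<forall>Y\<in>\<Y>. \<forall>x\<in>topspace X \<inter> Y. \<exists>\<^sub>\<infinity>n. x \<in> W n (f Y n)"
    by metis
  then have f: "\<And>Y x. Y \<in> \<Y> \<Longrightarrow> x \<in> topspace X \<Longrightarrow> x \<in> Y \<Longrightarrow> \<exists>\<^sub>\<infinity>n. x \<in> W n (f Y n)"
    by blast
  obtain g where g: "\<forall>Y\<in>\<Y>. \<forall>\<^sub>\<infinity>n. f Y n \<le> g n"
    using bounded_if_less_bounding_number[OF \<Y>(1), where f = f] unfolding le_star_def ..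
  show ?thesis
  proof (intro exI[of _ g] ballI)
    fix x assume x: "x \<in> topspace X"
    then obtain Y where Y: "Y \<in> \<Y>" "x \<in> Y"
      using \<Y>(2) by blast
    have "\<forall>\<^sub>\<infinity>n. x \<in> W n (f Y n) \<longrightarrow> x \<in> W n (g n)"
      using g[rule_format, OF Y(1)] by eventually_elim (blast intro: increasing_coversD[OF assms(2)])
    then show "\<exists>\<^sub>\<infinity>n. x \<in> W n (g n)"
      using f[OF Y(1) x Y(2)] by (rule frequently_mp)
  qed
qed

section \<open>Stars\<close>

lemma St_mono: "A \<subseteq> B \<Longrightarrow> St A \<U> \<subseteq> St B \<U>"
  unfolding St_def by blast

lemma St_UN: "St (\<Union>i\<in>I. A i) \<U> = (\<Union>i\<in>I. St (A i) \<U>)"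
  unfolding St_def by blast

lemma St_subset_topspace: "open_cover X \<U> \<Longrightarrow> St A \<U> \<subseteq> topspace X"
  unfolding St_def open_cover_def by blast

lemma openin_St: "open_cover X \<U> \<Longrightarrow> openin X (St A \<U>)"
  unfolding St_def open_cover_def by (blast intro: openin_Union)

text \<open>The injection of \<open>C\<close> into the natural numbers is used instead of an enumeration of \<open>C\<close>,
  so that empty and finite \<open>C\<close> need no separate treatment.\<close>

lemma countable_exhaustion:
  assumes "countable C"
  shows "\<exists>E :: nat \<Rightarrow> 'a set. (\<forall>m. finite (E m)) \<and> mono E \<and> (\<Union>m. E m) = C"
proof (intro exI conjI allI)
  let ?E = "\<lambda>m. {x \<in> C. to_nat_on C x \<le> m}"
  show "finite (?E m)" for m
    by (rule inj_on_finite[of "to_nat_on C" _ "{..m}"])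
      (auto intro: inj_on_subset[OF inj_on_to_nat_on[OF assms]])
  show "mono ?E"
    by (auto simp: mono_def)
  show "(\<Union>m. ?E m) = C"
    by auto
qed

lemma increasing_covers_St:
  assumes "\<And>n. open_cover X (\<U> n)" "\<And>n. mono (A n)" "\<And>n. St (\<Union>m. A n m) (\<U> n) = topspace X"
  shows "increasing_covers X (\<lambda>n m. St (A n m) (\<U> n))"
proof -
  have "mono (\<lambda>m. St (A n m) (\<U> n))" for n
    using assms(2)[of n] by (auto simp: mono_def intro: St_mono[THEN subsetD])
  moreover have "open_cover X (range (\<lambda>m. St (A n m) (\<U> n)))" for n
    using assms(3)[of n] openin_St[OF assms(1)]
    by (subst open_cover_def) (auto simp: St_UN)
  ultimately show ?thesis
    by (simp add: increasing_covers_def)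
qed

lemma strongly_star_Lindelof_exhaustion:
  assumes "strongly_star_Lindelof X" "\<And>n. open_cover X (\<U> n)"
  shows "\<exists>E. (\<forall>n m. finite (E n m) \<and> E n m \<subseteq> topspace X) \<and>
    increasing_covers X (\<lambda>n m. St (E n m) (\<U> n))"
proof -
  have "\<forall>n. \<exists>C. countable C \<and> C \<subseteq> topspace X \<and> St C (\<U> n) = topspace X"
    using assms unfolding strongly_star_Lindelof_def by blast
  then obtain C where
    C: "\<forall>n. countable (C n) \<and> C n \<subseteq> topspace X \<and> St (C n) (\<U> n) = topspace X"
    unfolding choice_iff ..
  then have "\<forall>n. \<exists>E :: nat \<Rightarrow> 'a set. (\<forall>m. finite (E m)) \<and> mono E \<and> (\<Union>m. E m) = C n"
    using countable_exhaustion by blast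
  then obtain E :: "nat \<Rightarrow> nat \<Rightarrow> 'a set" where
    E: "\<forall>n. (\<forall>m. finite (E n m)) \<and> mono (E n) \<and> (\<Union>m. E n m) = C n"
    unfolding choice_iff ..
  have "finite (E n m) \<and> E n m \<subseteq> topspace X" for n m
    using C[rule_format, of n] E[rule_format, of n] by blast
  moreover have "increasing_covers X (\<lambda>n m. St (E n m) (\<U> n))"
    by (rule increasing_covers_St[OF assms(2)]) (simp_all add: E C)
  ultimately show ?thesis
    by blast
qed

lemma star_Lindelof_exhaustion:
  assumes "star_Lindelof X" "\<And>n. open_cover X (\<U> n)"
  shows "\<exists>\<E>. (\<forall>n m. finite (\<E> n m) \<and> \<E> n m \<subseteq> \<U> n) \<and>
    increasing_covers X (\<lambda>n m. St (\<Union>(\<E> n m)) (\<U> n))"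
proof -
  have "\<forall>n. \<exists>\<C>. countable \<C> \<and> \<C> \<subseteq> \<U> n \<and> St (\<Union>\<C>) (\<U> n) = topspace X"
    using assms unfolding star_Lindelof_def by blast
  then obtain \<C> where
    \<C>: "\<forall>n. countable (\<C> n) \<and> \<C> n \<subseteq> \<U> n \<and> St (\<Union>(\<C> n)) (\<U> n) = topspace X"
    unfolding choice_iff ..
  then have "\<forall>n. \<exists>\<E> :: nat \<Rightarrow> 'a set set. (\<forall>m. finite (\<E> m)) \<and> mono \<E> \<and> (\<Union>m. \<E> m) = \<C> n"
    using countable_exhaustion by blast
  then obtain \<E> :: "nat \<Rightarrow> nat \<Rightarrow> 'a set set" where
    \<E>: "\<forall>n. (\<forall>m. finite (\<E> n m)) \<and> mono (\<E> n) \<and> (\<Union>m. \<E> n m) = \<C> n"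
    unfolding choice_iff ..
  have "finite (\<E> n m) \<and> \<E> n m \<subseteq> \<U> n" for n m
    using \<C>[rule_format, of n] \<E>[rule_format, of n] by blast
  moreover have "increasing_covers X (\<lambda>n m. St (\<Union>(\<E> n m)) (\<U> n))"
  proof (rule increasing_covers_St[OF assms(2)])
    show "mono (\<lambda>m. \<Union>(\<E> n m))" for n
      using \<E> by (simp add: mono_def Union_mono)
    have "(\<Union>m. \<Union>(\<E> n m)) = \<Union>(\<Union>m. \<E> n m)" for n
      by blast
    then have "(\<Union>m. \<Union>(\<E> n m)) = \<Union>(\<C> n)" for n
      using \<E> by simp
    then show "St (\<Union>m. \<Union>(\<E> n m)) (\<U> n) = topspace X" for n
      using \<C> by simp
  qed
  ultimately show ?thesis
    by blast
qed

section \<open>From finite exhaustions to star selection principles\<close>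

text \<open>The finite kernel selected from the exhaustion \<open>E n\<close> at stage \<open>n\<close> is its member of index
  \<open>g n\<close>, so a selection principle only asks for a suitable \<open>g\<close>. The hypothesis speaks of
  arbitrary increasing covers because the exhaustion, and hence its stars, depend on the
  given covers.\<close>

lemma strongly_star_MengerI:
  assumes "strongly_star_Lindelof X"
    and "\<And>W. increasing_covers X W \<Longrightarrow> \<exists>g. \<forall>x\<in>topspace X. \<exists>\<^sub>\<infinity>n. x \<in> W n (g n)"
  shows "strongly_star_Menger X"
  unfolding strongly_star_Menger_def
proof (intro allI impI)
  fix \<U> :: "nat \<Rightarrow> 'a set set" assume \<U>: "\<forall>n. open_cover X (\<U> n)"
  then have "open_cover X (\<U> n)" for n ..
  from strongly_star_Lindelof_exhaustion[where \<U> = \<U>, OF assms(1) this] obtain E where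
    E: "\<forall>n m. finite (E n m) \<and> E n m \<subseteq> topspace X"
    and W: "increasing_covers X (\<lambda>n m. St (E n m) (\<U> n))"
    by blast
  obtain g where g: "\<forall>x\<in>topspace X. \<exists>\<^sub>\<infinity>n. x \<in> St (E n (g n)) (\<U> n)"
    using assms(2)[OF W] ..
  have "(\<Union>n. St (E n (g n)) (\<U> n)) = topspace X"
    using \<U> St_subset_topspace g[rule_format, THEN frequently_ex] by fast
  with E show "\<exists>F. (\<forall>n. finite (F n) \<and> F n \<subseteq> topspace X) \<and>
      (\<Union>n. St (F n) (\<U> n)) = topspace X"
    by (intro exI[of _ "\<lambda>n. E n (g n)"]) blast
qed

lemma strongly_star_HurewiczI:
  assumes "strongly_star_Lindelof X"
    and "\<And>W. increasing_covers X W \<Longrightarrow> \<exists>g. \<forall>x\<in>topspace X. \<forall>\<^sub>\<infinity>n. x \<in> W n (g n)"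
  shows "strongly_star_Hurewicz X"
  unfolding strongly_star_Hurewicz_def
proof (intro allI impI)
  fix \<U> :: "nat \<Rightarrow> 'a set set" assume "\<forall>n. open_cover X (\<U> n)"
  then have "open_cover X (\<U> n)" for n ..
  from strongly_star_Lindelof_exhaustion[where \<U> = \<U>, OF assms(1) this] obtain E where
    E: "\<forall>n m. finite (E n m) \<and> E n m \<subseteq> topspace X"
    and W: "increasing_covers X (\<lambda>n m. St (E n m) (\<U> n))"
    by blast
  obtain g where "\<forall>x\<in>topspace X. \<forall>\<^sub>\<infinity>n. x \<in> St (E n (g n)) (\<U> n)"
    using assms(2)[OF W] ..
  with E show "\<exists>F. (\<forall>n. finite (F n) \<and> F n \<subseteq> topspace X) \<and>
      (\<forall>x\<in>topspace X. \<forall>\<^sub>\<infinity>n. x \<in> St (F n) (\<U> n))"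
    by (intro exI[of _ "\<lambda>n. E n (g n)"]) blast
qed

lemma star_MengerI:
  assumes "star_Lindelof X"
    and "\<And>W. increasing_covers X W \<Longrightarrow> \<exists>g. \<forall>x\<in>topspace X. \<exists>\<^sub>\<infinity>n. x \<in> W n (g n)"
  shows "star_Menger X"
  unfolding star_Menger_def
proof (intro allI impI)
  fix \<U> :: "nat \<Rightarrow> 'a set set" assume \<U>: "\<forall>n. open_cover X (\<U> n)"
  then have "open_cover X (\<U> n)" for n ..
  from star_Lindelof_exhaustion[where \<U> = \<U>, OF assms(1) this] obtain \<E> where
    \<E>: "\<forall>n m. finite (\<E> n m) \<and> \<E> n m \<subseteq> \<U> n"
    and W: "increasing_covers X (\<lambda>n m. St (\<Union>(\<E> n m)) (\<U> n))"
    by blast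
  obtain g where g: "\<forall>x\<in>topspace X. \<exists>\<^sub>\<infinity>n. x \<in> St (\<Union>(\<E> n (g n))) (\<U> n)"
    using assms(2)[OF W] ..
  have "(\<Union>n. St (\<Union>(\<E> n (g n))) (\<U> n)) = topspace X"
    using \<U> St_subset_topspace g[rule_format, THEN frequently_ex] by fast
  with \<E> show "\<exists>\<V>. (\<forall>n. finite (\<V> n) \<and> \<V> n \<subseteq> \<U> n) \<and>
      (\<Union>n. St (\<Union>(\<V> n)) (\<U> n)) = topspace X"
    by (intro exI[of _ "\<lambda>n. \<E> n (g n)"]) blast
qed

lemma star_HurewiczI:
  assumes "star_Lindelof X"
    and "\<And>W. increasing_covers X W \<Longrightarrow> \<exists>g. \<forall>x\<in>topspace X. \<forall>\<^sub>\<infinity>n. x \<in> W n (g n)"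
  shows "star_Hurewicz X"
  unfolding star_Hurewicz_def
proof (intro allI impI)
  fix \<U> :: "nat \<Rightarrow> 'a set set" assume "\<forall>n. open_cover X (\<U> n)"
  then have "open_cover X (\<U> n)" for n ..
  from star_Lindelof_exhaustion[where \<U> = \<U>, OF assms(1) this] obtain \<E> where
    \<E>: "\<forall>n m. finite (\<E> n m) \<and> \<E> n m \<subseteq> \<U> n"
    and W: "increasing_covers X (\<lambda>n m. St (\<Union>(\<E> n m)) (\<U> n))"
    by blast
  obtain g where "\<forall>x\<in>topspace X. \<forall>\<^sub>\<infinity>n. x \<in> St (\<Union>(\<E> n (g n))) (\<U> n)"
    using assms(2)[OF W] ..
  with \<E> show "\<exists>\<V>. (\<forall>n. finite (\<V> n) \<and> \<V> n \<subseteq> \<U> n) \<and>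
      (\<forall>x\<in>topspace X. \<forall>\<^sub>\<infinity>n. x \<in> St (\<Union>(\<V> n)) (\<U> n))"
    by (intro exI[of _ "\<lambda>n. \<E> n (g n)"]) blast
qed

section \<open>Implications between the covering properties\<close>

lemma Hurewicz_imp_Menger:
  assumes "Hurewicz X"
  shows "Menger X"
  unfolding Menger_def
proof (intro allI impI)
  fix \<U> :: "nat \<Rightarrow> 'a set set" assume \<U>: "\<forall>n. open_cover X (\<U> n)"
  with assms obtain \<V> where
    \<V>: "\<forall>n. finite (\<V> n) \<and> \<V> n \<subseteq> \<U> n" "\<forall>x\<in>topspace X. \<forall>\<^sub>\<infinity>n. x \<in> \<Union>(\<V> n)"
    unfolding Hurewicz_def by meson
  have "\<Union>(\<V> n) \<subseteq> topspace X" for n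
    using \<U> \<V>(1) Union_mono[of "\<V> n" "\<U> n"] by (simp add: open_cover_def)
  moreover have "\<exists>n. x \<in> \<Union>(\<V> n)" if "x \<in> topspace X" for x
    using eventually_happens'[OF _ \<V>(2)[rule_format, OF that]] by (simp add: cofinite_bot)
  ultimately have "(\<Union>n. \<Union>(\<V> n)) = topspace X"
    by fast
  with \<V>(1) show "\<exists>\<V>. (\<forall>n. finite (\<V> n) \<and> \<V> n \<subseteq> \<U> n) \<and> (\<Union>n. \<Union>(\<V> n)) = topspace X"
    by (intro exI conjI)
qed

lemma stars_cover_if_eventually:
  assumes "\<forall>n. open_cover X (\<U> n)" "\<forall>x\<in>topspace X. \<forall>\<^sub>\<infinity>n. x \<in> St (A n) (\<U> n)"
  shows "(\<Union>n::nat. St (A n) (\<U> n)) = topspace X"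
proof -
  have "\<exists>n. x \<in> St (A n) (\<U> n)" if "x \<in> topspace X" for x
    using eventually_happens'[OF _ assms(2)[rule_format, OF that]] by (simp add: cofinite_bot)
  then show ?thesis
    using St_subset_topspace assms(1) by fast
qed

lemma strongly_star_Hurewicz_imp_strongly_star_Menger:
  assumes "strongly_star_Hurewicz X"
  shows "strongly_star_Menger X"
  unfolding strongly_star_Menger_def
proof (intro allI impI)
  fix \<U> :: "nat \<Rightarrow> 'a set set" assume \<U>: "\<forall>n. open_cover X (\<U> n)"
  with assms obtain F where F: "\<forall>n. finite (F n) \<and> F n \<subseteq> topspace X"
      "\<forall>x\<in>topspace X. \<forall>\<^sub>\<infinity>n. x \<in> St (F n) (\<U> n)"
    unfolding strongly_star_Hurewicz_def by meson
  from F(1) stars_cover_if_eventually[OF \<U> F(2)]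
  show "\<exists>F. (\<forall>n. finite (F n) \<and> F n \<subseteq> topspace X) \<and> (\<Union>n. St (F n) (\<U> n)) = topspace X"
    by (intro exI conjI)
qed

lemma star_Hurewicz_imp_star_Menger:
  assumes "star_Hurewicz X"
  shows "star_Menger X"
  unfolding star_Menger_def
proof (intro allI impI)
  fix \<U> :: "nat \<Rightarrow> 'a set set" assume \<U>: "\<forall>n. open_cover X (\<U> n)"
  with assms obtain \<V> where \<V>: "\<forall>n. finite (\<V> n) \<and> \<V> n \<subseteq> \<U> n"
      "\<forall>x\<in>topspace X. \<forall>\<^sub>\<infinity>n. x \<in> St (\<Union>(\<V> n)) (\<U> n)"
    unfolding star_Hurewicz_def by meson
  from \<V>(1) stars_cover_if_eventually[OF \<U> \<V>(2)]
  show "\<exists>\<V>. (\<forall>n. finite (\<V> n) \<and> \<V> n \<subseteq> \<U> n) \<and>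
      (\<Union>n. St (\<Union>(\<V> n)) (\<U> n)) = topspace X"
    by (intro exI conjI)
qed

text \<open>A member of the cover that contains a point meets every member that the point belongs to.
  So points of a kernel can be traded for members of the cover without shrinking the star, and
  writing the members as an image of \<open>F\<close> keeps the kernel finite or countable.\<close>

lemma points_to_members:
  assumes "open_cover X \<U>" "F \<subseteq> topspace X"
  obtains u where "u ` F \<subseteq> \<U>" "St F \<U> \<subseteq> St (\<Union>(u ` F)) \<U>"
proof -
  have "\<forall>x\<in>F. \<exists>U\<in>\<U>. x \<in> U"
    using assms unfolding open_cover_def by blast
  then obtain u where "\<forall>x\<in>F. u x \<in> \<U> \<and> x \<in> u x"
    by metis
  then show thesis
    by (intro that[of u] St_mono) auto
qed

lemma points_to_members_sequence:
  assumes "\<forall>n. open_cover X (\<U> n)" "\<forall>n. finite (F n) \<and> F n \<subseteq> topspace X"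
  shows "\<exists>\<V>. (\<forall>n. finite (\<V> n) \<and> \<V> n \<subseteq> \<U> n) \<and>
    (\<forall>n. St (F n) (\<U> n) \<subseteq> St (\<Union>(\<V> n)) (\<U> n))"
proof -
  have "\<exists>\<V>. finite \<V> \<and> \<V> \<subseteq> \<U> n \<and> St (F n) (\<U> n) \<subseteq> St (\<Union>\<V>) (\<U> n)" for n
    using points_to_members[of X "\<U> n" "F n"] assms by (metis finite_imageI)
  then show ?thesis
    by metis
qed

lemma strongly_star_Lindelof_imp_star_Lindelof:
  assumes "strongly_star_Lindelof X"
  shows "star_Lindelof X"
  unfolding star_Lindelof_def
proof (intro allI impI)
  fix \<U> assume \<U>: "open_cover X \<U>"
  with assms obtain F where F: "countable F" "F \<subseteq> topspace X" "St F \<U> = topspace X"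
    unfolding strongly_star_Lindelof_def by blast
  obtain u where "u ` F \<subseteq> \<U>" "St F \<U> \<subseteq> St (\<Union>(u ` F)) \<U>"
    using points_to_members[OF \<U> F(2)] by blast
  then show "\<exists>\<V>. countable \<V> \<and> \<V> \<subseteq> \<U> \<and> St (\<Union>\<V>) \<U> = topspace X"
    using F St_subset_topspace[OF \<U>, of "\<Union>(u ` F)"] by (intro exI[of _ "u ` F"]) auto
qed

lemma strongly_star_Menger_imp_star_Menger:
  assumes "strongly_star_Menger X"
  shows "star_Menger X"
  unfolding star_Menger_def
proof (intro allI impI)
  fix \<U> :: "nat \<Rightarrow> 'a set set" assume \<U>: "\<forall>n. open_cover X (\<U> n)"
  with assms obtain F where F: "\<forall>n. finite (F n) \<and> F n \<subseteq> topspace X"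
      "(\<Union>n. St (F n) (\<U> n)) = topspace X"
    unfolding strongly_star_Menger_def by meson
  obtain \<V> where \<V>: "\<forall>n. finite (\<V> n) \<and> \<V> n \<subseteq> \<U> n"
      "\<forall>n. St (F n) (\<U> n) \<subseteq> St (\<Union>(\<V> n)) (\<U> n)"
    using points_to_members_sequence[OF \<U> F(1)] by (elim exE conjE)
  have "(\<Union>n. St (\<Union>(\<V> n)) (\<U> n)) = topspace X"
  proof
    show "(\<Union>n. St (\<Union>(\<V> n)) (\<U> n)) \<subseteq> topspace X"
      using \<U> by (simp add: UN_least St_subset_topspace)
    show "topspace X \<subseteq> (\<Union>n. St (\<Union>(\<V> n)) (\<U> n))"
      unfolding F(2)[symmetric] using \<V>(2) by (simp add: UN_mono)
  qed
  with \<V>(1) show "\<exists>\<V>. (\<forall>n. finite (\<V> n) \<and> \<V> n \<subseteq> \<U> n) \<and>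
      (\<Union>n. St (\<Union>(\<V> n)) (\<U> n)) = topspace X"
    by (intro exI conjI ballI)
qed

lemma strongly_star_Hurewicz_imp_star_Hurewicz:
  assumes "strongly_star_Hurewicz X"
  shows "star_Hurewicz X"
  unfolding star_Hurewicz_def
proof (intro allI impI)
  fix \<U> :: "nat \<Rightarrow> 'a set set" assume \<U>: "\<forall>n. open_cover X (\<U> n)"
  with assms obtain F where F: "\<forall>n. finite (F n) \<and> F n \<subseteq> topspace X"
      "\<forall>x\<in>topspace X. \<forall>\<^sub>\<infinity>n. x \<in> St (F n) (\<U> n)"
    unfolding strongly_star_Hurewicz_def by meson
  obtain \<V> where \<V>: "\<forall>n. finite (\<V> n) \<and> \<V> n \<subseteq> \<U> n"
      "\<forall>n. St (F n) (\<U> n) \<subseteq> St (\<Union>(\<V> n)) (\<U> n)"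
    using points_to_members_sequence[OF \<U> F(1)] by (elim exE conjE)
  have "\<forall>\<^sub>\<infinity>n. x \<in> St (\<Union>(\<V> n)) (\<U> n)" if "x \<in> topspace X" for x
    using F(2)[rule_format, OF that] by eventually_elim (use \<V>(2) in blast)
  with \<V>(1) show "\<exists>\<V>. (\<forall>n. finite (\<V> n) \<and> \<V> n \<subseteq> \<U> n) \<and>
      (\<forall>x\<in>topspace X. \<forall>\<^sub>\<infinity>n. x \<in> St (\<Union>(\<V> n)) (\<U> n))"
    by (intro exI conjI ballI)
qed

lemma with_union_mono:
  assumes "with_union A \<kappa> B X" "A X \<Longrightarrow> A' X" "\<kappa> \<le>o \<kappa>'"
    "\<And>Y. B (subtopology X Y) \<Longrightarrow> B' (subtopology X Y)"
  shows "with_union A' \<kappa>' B' X"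
  using assms unfolding with_union_def by (meson ordLess_ordLeq_trans)

lemma with_unionD: "with_union A \<kappa> B X \<Longrightarrow> A X"
  by (simp add: with_union_def)

lemma ordLeq_refl_cardinals: "\<bb> \<le>o \<bb>" "\<dd> \<le>o \<dd>"
  unfolding bounding_number_def dominating_number_def least_cardinality_def
  by (simp_all add: card_of_refl ordIso_imp_ordLeq)

section \<open>The implications\<close>

theorem theorem2p10:
  fixes X :: "'a topology"
  assumes "regular_space X" and "t1_space X"
  shows
    "(with_union strongly_star_Lindelof \<dd> Hurewicz X \<longrightarrow> strongly_star_Menger X) \<and>
     (with_union strongly_star_Lindelof \<bb> Hurewicz X \<longrightarrow> strongly_star_Hurewicz X) \<and>
     (with_union strongly_star_Lindelof \<bb> Menger X \<longrightarrow> strongly_star_Menger X) \<and>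
     (with_union star_Lindelof \<dd> Hurewicz X \<longrightarrow> star_Menger X) \<and>
     (with_union star_Lindelof \<bb> Hurewicz X \<longrightarrow> star_Hurewicz X) \<and>
     (with_union star_Lindelof \<bb> Menger X \<longrightarrow> star_Menger X) \<and>
     ((with_union strongly_star_Lindelof \<bb> Hurewicz X \<longrightarrow>
         with_union strongly_star_Lindelof \<dd> Hurewicz X) \<and>
      (with_union strongly_star_Lindelof \<bb> Hurewicz X \<longrightarrow>
         with_union strongly_star_Lindelof \<bb> Menger X)) \<and>
     ((with_union star_Lindelof \<bb> Hurewicz X \<longrightarrow> with_union star_Lindelof \<dd> Hurewicz X) \<and>
      (with_union star_Lindelof \<bb> Hurewicz X \<longrightarrow> with_union star_Lindelof \<bb> Menger X)) \<and>
     ((with_union strongly_star_Lindelof \<dd> Hurewicz X \<longrightarrow> with_union star_Lindelof \<dd> Hurewicz X) \<and>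
      (with_union strongly_star_Lindelof \<bb> Hurewicz X \<longrightarrow> with_union star_Lindelof \<bb> Hurewicz X) \<and>
      (with_union strongly_star_Lindelof \<bb> Menger X \<longrightarrow> with_union star_Lindelof \<bb> Menger X)) \<and>
     ((strongly_star_Hurewicz X \<longrightarrow> strongly_star_Menger X) \<and>
      (star_Hurewicz X \<longrightarrow> star_Menger X) \<and>
      (strongly_star_Hurewicz X \<longrightarrow> star_Hurewicz X) \<and>
      (strongly_star_Menger X \<longrightarrow> star_Menger X))"
proof (intro conjI impI)
  assume h: "with_union strongly_star_Lindelof \<dd> Hurewicz X"
  show "strongly_star_Menger X"
    by (rule strongly_star_MengerI[OF with_unionD[OF h]])
      (rule union_less_dominating_Hurewicz_function[OF h])
next
  assume h: "with_union strongly_star_Lindelof \<bb> Hurewicz X"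
  show "strongly_star_Hurewicz X"
    by (rule strongly_star_HurewiczI[OF with_unionD[OF h]])
      (rule union_less_bounding_Hurewicz_function[OF h])
next
  assume h: "with_union strongly_star_Lindelof \<bb> Menger X"
  show "strongly_star_Menger X"
    by (rule strongly_star_MengerI[OF with_unionD[OF h]])
      (rule union_less_bounding_Menger_function[OF h])
next
  assume h: "with_union star_Lindelof \<dd> Hurewicz X"
  show "star_Menger X"
    by (rule star_MengerI[OF with_unionD[OF h]])
      (rule union_less_dominating_Hurewicz_function[OF h])
next
  assume h: "with_union star_Lindelof \<bb> Hurewicz X"
  show "star_Hurewicz X"
    by (rule star_HurewiczI[OF with_unionD[OF h]])
      (rule union_less_bounding_Hurewicz_function[OF h])
next
  assume h: "with_union star_Lindelof \<bb> Menger X"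
  show "star_Menger X"
    by (rule star_MengerI[OF with_unionD[OF h]])
      (rule union_less_bounding_Menger_function[OF h])
qed (blast intro: with_union_mono bounding_number_le_dominating_number ordLeq_refl_cardinals
      Hurewicz_imp_Menger strongly_star_Lindelof_imp_star_Lindelof
      strongly_star_Hurewicz_imp_strongly_star_Menger star_Hurewicz_imp_star_Menger
      strongly_star_Hurewicz_imp_star_Hurewicz strongly_star_Menger_imp_star_Menger)+

end
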